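(* If $G$ is a graph, $S \subseteq V(G)$, and $x \in V(G)$, then $$\gamma_g'(G|S) \leq \gamma_g'(G|(S\cup N[x])) +2.$$
   Context: Graphs are finite and simple. $N[x]$ denotes the closed neighborhood of $x$ (the vertex $x$ together with its neighbors); a vertex $x$ dominates every vertex of $N[x]$. For $S\subseteq V(G)$, $G|S$ denotes the partially dominated graph $G$ in which the vertices of $S$ are declared to be already dominated at the start (they need not be dominated during the game, but may still be played if this dominates a new vertex). The domination game on $G|S$ is played by Dominator and Staller, who take turns choosing a vertex of $G$ such that at least one previously undominated vertex becomes dominated. The game is over when all vertices of $G$ are dominated. Dominator wants to minimize the number of vertices played, Staller wants to maximize it. In the S-game Staller has the first move, and $\gamma_g'(G|S)$ is the number of moves in the S-game played on $G|S$ when both players play optimally. *)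

theory Defs
  imports "Graph_Theory.Pair_Digraph"
begin

text \<open>
  Finite simple graphs are the \<^locale>\<open>pair_graph\<close>s of the library: every edge \<open>xy\<close> is
  represented by the two arcs \<open>(x, y)\<close> and \<open>(y, x)\<close>.
\<close>

datatype player = Dominator | Staller

context pair_graph
begin

definition closed_nbhd :: "'a \<Rightarrow> 'a set" where
  "closed_nbhd x = insert x {y. (x, y) \<in> parcs G}"

definition legal_moves :: "'a set \<Rightarrow> 'a set" where
  "legal_moves D = {v \<in> pverts G. \<not> closed_nbhd v \<subseteq> D}"

lemma closed_nbhd_subset: "v \<in> pverts G \<Longrightarrow> closed_nbhd v \<subseteq> pverts G"
  by (auto simp: closed_nbhd_def dest: in_arcsD2)

lemma finite_legal_moves: "finite (legal_moves D)"
  by (simp add: legal_moves_def pair_finite_verts)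

lemma legal_moves_eq_empty_iff: "legal_moves D = {} \<longleftrightarrow> pverts G \<subseteq> D"
  using closed_nbhd_subset by (fastforce simp: legal_moves_def closed_nbhd_def)

lemma card_undominated_less:
  assumes "v \<in> legal_moves D"
  shows "card (pverts G - (D \<union> closed_nbhd v)) < card (pverts G - D)"
proof (rule psubset_card_mono)
  show "finite (pverts G - D)"
    using pair_finite_verts by simp
  show "pverts G - (D \<union> closed_nbhd v) \<subset> pverts G - D"
    using assms closed_nbhd_subset[of v] by (auto simp: legal_moves_def)
qed

text \<open>
  The minimax value of the position in which \<open>p\<close> is to move and \<open>D\<close> is the set of dominated
  vertices, that is, the number of moves still to be played under optimal play.
  The sets under \<open>Min\<close> and \<open>Max\<close> are finite and nonempty, see \<open>finite_legal_moves\<close>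
  and \<open>legal_moves_eq_empty_iff\<close>.
\<close>

function game_length :: "player \<Rightarrow> 'a set \<Rightarrow> nat" where
  "game_length Dominator D =
     (if pverts G \<subseteq> D then 0
      else 1 + Min ((\<lambda>v. game_length Staller (D \<union> closed_nbhd v)) ` legal_moves D))"
| "game_length Staller D =
     (if pverts G \<subseteq> D then 0
      else 1 + Max ((\<lambda>v. game_length Dominator (D \<union> closed_nbhd v)) ` legal_moves D))"
  by pat_completeness auto
termination
  by (relation "Wellfounded.measure (\<lambda>(p, D). card (pverts G - D))")
     (simp_all add: card_undominated_less)

declare game_length.simps [simp del]

text \<open>The S-game domination number of the partially dominated graph \<open>G|S\<close>.\<close>

definition S_game_domination_number :: "'a set \<Rightarrow> nat" where
  "S_game_domination_number S = game_length Staller S"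

end

end

theory Submission
  imports Defs
begin

text \<open>
  Dominator imagines that the vertices of \<open>N[x]\<close> are dominated already, and answers according to an
  optimal strategy for the imagined position. As soon as Staller plays a move that is illegal in the
  imagined position, Dominator plays \<open>x\<close> (or, if \<open>x\<close> is illegal, any move: by the continuation
  principle this does not hurt), which makes the two positions agree again at the cost of two moves.
\<close>

context pair_graph
begin

lemma legal_moves_antimono: "A \<subseteq> B \<Longrightarrow> legal_moves B \<subseteq> legal_moves A"
  by (auto simp: legal_moves_def)

lemma game_length_eq_0: "pverts G \<subseteq> D \<Longrightarrow> game_length p D = 0"
  by (cases p) (simp_all add: game_length.simps[of D])

lemma game_length_Dominator_le:
  assumes "v \<in> legal_moves D"
  shows "game_length Dominator D \<le> 1 + game_length Staller (D \<union> closed_nbhd v)"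
proof -
  have "\<not> pverts G \<subseteq> D"
    using assms legal_moves_eq_empty_iff by blast
  then show ?thesis
    using assms by (simp add: game_length.simps(1)[of D] finite_legal_moves)
qed

lemma game_length_Staller_ge:
  assumes "v \<in> legal_moves D"
  shows "1 + game_length Dominator (D \<union> closed_nbhd v) \<le> game_length Staller D"
proof -
  have "\<not> pverts G \<subseteq> D"
    using assms legal_moves_eq_empty_iff by blast
  then show ?thesis
    using assms by (simp add: game_length.simps(2)[of D] finite_legal_moves)
qed

lemma optimal_Dominator_move:
  assumes "\<not> pverts G \<subseteq> D"
  obtains v where "v \<in> legal_moves D"
    and "game_length Dominator D = 1 + game_length Staller (D \<union> closed_nbhd v)"
proof -
  let ?X = "(\<lambda>v. game_length Staller (D \<union> closed_nbhd v)) ` legal_moves D"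
  have "Min ?X \<in> ?X"
    using assms legal_moves_eq_empty_iff finite_legal_moves by (intro Min_in) auto
  then obtain v where "v \<in> legal_moves D" "Min ?X = game_length Staller (D \<union> closed_nbhd v)"
    by blast
  then show thesis
    using assms by (intro that[of v]) (simp_all add: game_length.simps(1)[of D])
qed

lemma optimal_Staller_move:
  assumes "\<not> pverts G \<subseteq> D"
  obtains v where "v \<in> legal_moves D"
    and "game_length Staller D = 1 + game_length Dominator (D \<union> closed_nbhd v)"
proof -
  let ?X = "(\<lambda>v. game_length Dominator (D \<union> closed_nbhd v)) ` legal_moves D"
  have "Max ?X \<in> ?X"
    using assms legal_moves_eq_empty_iff finite_legal_moves by (intro Max_in) auto
  then obtain v where "v \<in> legal_moves D" "Max ?X = game_length Dominator (D \<union> closed_nbhd v)"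
    by blast
  then show thesis
    using assms by (intro that[of v]) (simp_all add: game_length.simps(2)[of D])
qed

text \<open>Induction on the number of vertices undominated in \<open>A\<close>, comparing one move
  in both positions. An optimal Staller move in \<open>B\<close> is legal in \<open>A\<close>, where
  it is one of her options. For Dominator the roles are reversed: his optimal move in
  \<open>A\<close> is transferred to \<open>B\<close>.\<close>

lemma continuation_principle: "A \<subseteq> B \<Longrightarrow> game_length p B \<le> game_length p A"
proof (induction "card (pverts G - A)" arbitrary: A B p rule: less_induct)
  case less
  have IH: "game_length q B' \<le> game_length q (A \<union> closed_nbhd v)"
    if "v \<in> legal_moves A" "A \<union> closed_nbhd v \<subseteq> B'" for v B' q
    using less.hyps card_undominated_less that by blast
  show ?case
  proof (cases "pverts G \<subseteq> B")
    case True
    then show ?thesis by (simp add: game_length_eq_0)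
  next
    case False
    then have "\<not> pverts G \<subseteq> A"
      using less.prems by blast
    show ?thesis
    proof (cases p)
      case Staller
      obtain v where v: "v \<in> legal_moves B"
        "game_length Staller B = 1 + game_length Dominator (B \<union> closed_nbhd v)"
        using optimal_Staller_move[OF False] .
      have vA: "v \<in> legal_moves A"
        using v legal_moves_antimono[OF less.prems] by blast
      have "game_length Dominator (B \<union> closed_nbhd v) \<le> game_length Dominator (A \<union> closed_nbhd v)"
        using less.prems by (intro IH[OF vA]) blast
      then show ?thesis
        using game_length_Staller_ge[OF vA] v Staller by simp
    next
      case Dominator
      obtain w where w: "w \<in> legal_moves A"
        "game_length Dominator A = 1 + game_length Staller (A \<union> closed_nbhd w)"
        using optimal_Dominator_move[OF \<open>\<not> pverts G \<subseteq> A\<close>] .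
      \<comment> \<open>Dominator copies \<open>w\<close> when it is legal in \<open>B\<close>.
        Otherwise \<open>B\<close> already contains \<open>closed_nbhd w\<close>, and any legal
        \<open>u\<close> keeps the position in \<open>B\<close> above the one in
        \<open>A\<close>.\<close>
      obtain u where u: "u \<in> legal_moves B" "closed_nbhd w \<subseteq> B \<union> closed_nbhd u"
      proof (cases "w \<in> legal_moves B")
        case True
        then show ?thesis using that by blast
      next
        case nonlegal: False
        then have "closed_nbhd w \<subseteq> B"
          using w by (auto simp: legal_moves_def)
        then show ?thesis
          using that False legal_moves_eq_empty_iff by blast
      qed
      have "game_length Staller (B \<union> closed_nbhd u) \<le> game_length Staller (A \<union> closed_nbhd w)"
        using less.prems u by (intro IH[OF w(1)]) blast
      then show ?thesis
        using game_length_Dominator_le[OF u(1)] w Dominator by simp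
    qed
  qed
qed

text \<open>If \<open>x\<close> is illegal, then \<open>D\<close> already contains its closed
  neighborhood, so the right-hand side is one move followed by Staller's turn at \<open>D\<close>.
  Any legal move of Dominator achieves at least this, by
  \<open>continuation_principle\<close>.\<close>

lemma game_length_Dominator_le_Staller_closed_nbhd:
  assumes "x \<in> pverts G"
  shows "game_length Dominator D \<le> 1 + game_length Staller (D \<union> closed_nbhd x)"
proof (cases "x \<in> legal_moves D")
  case True
  then show ?thesis by (rule game_length_Dominator_le)
next
  case False
  then have eq: "D \<union> closed_nbhd x = D"
    using assms by (auto simp: legal_moves_def)
  show ?thesis
  proof (cases "pverts G \<subseteq> D")
    case True
    then show ?thesis by (simp add: game_length_eq_0)
  next
    case False
    then obtain u where "u \<in> legal_moves D"
      using legal_moves_eq_empty_iff by blast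
    from game_length_Dominator_le[OF this]
    show ?thesis
      using continuation_principle[of D "D \<union> closed_nbhd u" Staller] eq by simp
  qed
qed

lemma game_length_Staller_le_closed_nbhd:
  assumes x: "x \<in> pverts G"
  shows "game_length Staller D \<le> game_length Staller (D \<union> closed_nbhd x) + 2"
proof (induction "card (pverts G - D)" arbitrary: D rule: less_induct)
  case less
  let ?E = "D \<union> closed_nbhd x"
  show ?case
  proof (cases "pverts G \<subseteq> D")
    case True
    then show ?thesis by (simp add: game_length_eq_0)
  next
    case False
    obtain v where v: "v \<in> legal_moves D"
      "game_length Staller D = 1 + game_length Dominator (D \<union> closed_nbhd v)"
      using optimal_Staller_move[OF False] .
    let ?D = "D \<union> closed_nbhd v"
    \<comment> \<open>Dominator's answer \<open>x\<close> merges the real and the imagined position.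
      It is used whenever the imagined game gives him no reply to copy: \<open>v\<close> is illegal
      there, or \<open>v\<close> ends it.\<close>
    have play_x: "game_length Dominator ?D \<le> 1 + game_length Staller (?E \<union> closed_nbhd v)"
      using game_length_Dominator_le_Staller_closed_nbhd[OF x, of ?D] by (simp add: ac_simps)
    show ?thesis
    proof (cases "v \<in> legal_moves ?E")
      case False
      \<comment> \<open>The imagined position does not change, so the real game spends exactly the
        two extra moves \<open>v\<close> and \<open>x\<close> before reaching it.\<close>
      then have "?E \<union> closed_nbhd v = ?E"
        using v by (auto simp: legal_moves_def)
      then show ?thesis
        using v play_x by simp
    next
      case True
      note E = game_length_Staller_ge[OF True]
      show ?thesis
      proof (cases "pverts G \<subseteq> ?E \<union> closed_nbhd v")
        case True
        \<comment> \<open>Only vertices of \<open>closed_nbhd x\<close> can still be undominated in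
          the real game, so it lasts at most the two moves \<open>v\<close> and
          \<open>x\<close>.\<close>
        then show ?thesis
          using v play_x by (simp add: game_length_eq_0)
      next
        case False
        obtain w where w: "w \<in> legal_moves (?E \<union> closed_nbhd v)"
          "game_length Dominator (?E \<union> closed_nbhd v)
             = 1 + game_length Staller (?E \<union> closed_nbhd v \<union> closed_nbhd w)"
          using optimal_Dominator_move[OF False] .
        have wD: "w \<in> legal_moves ?D"
          using w(1) legal_moves_antimono[of ?D "?E \<union> closed_nbhd v"] by blast
        have "game_length Staller (?D \<union> closed_nbhd w)
            \<le> game_length Staller (?D \<union> closed_nbhd w \<union> closed_nbhd x) + 2"
          using card_undominated_less[OF v(1)] card_undominated_less[OF wD]
          by (intro less.hyps) simp
        also have "?D \<union> closed_nbhd w \<union> closed_nbhd x = ?E \<union> closed_nbhd v \<union> closed_nbhd w"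
          by blast
        finally show ?thesis
          \<comment> \<open>The moves \<open>v\<close> and \<open>w\<close> count in both games, so
            the excess 2 carries over. In the real game \<open>w\<close> may be suboptimal, which
            gives an upper bound; in the imagined one \<open>v\<close> may be, which gives a lower
            bound.\<close>
          using game_length_Dominator_le[OF wD] v(2) w(2) E by simp
      qed
    qed
  qed
qed

end

theorem lemma2p1:
  fixes G :: "'a pair_pre_digraph" and S :: "'a set" and x :: 'a
  assumes "pair_graph G"
    and "S \<subseteq> pverts G"
    and "x \<in> pverts G"
  shows "pair_graph.S_game_domination_number G S
    \<le> pair_graph.S_game_domination_number G (S \<union> pair_graph.closed_nbhd G x) + 2"
proof -
  interpret pair_graph G by fact
  show ?thesis
    unfolding S_game_domination_number_def
    using assms(3) by (rule game_length_Staller_le_closed_nbhd)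
qed

end
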